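(* For all real numbers $p \geq 1$ and $x$ with $0 \leq x \leq \frac{1}{2}$, one has $$x^{p} + (1-x)^{\frac{1}{p}} \leq 1.$$
   Context: Powers are real powers of nonnegative real numbers (with $0^p = 0$ for $p \geq 1$). *)

theory Defs
  imports "HOL-Analysis.Analysis"
begin

end

theory Submission
  imports Defs
begin

text \<open>
  The exponent disappears after a change of variables. For \<open>0 < x < 1\<close> put \<open>u = x powr p\<close>, so that
  \<open>p = ln u / ln x\<close>. The claim \<open>(1 - x) powr (1 / p) \<le> 1 - u\<close> says \<open>ln (1 - x) \<le> p * ln (1 - u)\<close>,
  and multiplying by the negative number \<open>ln x\<close> turns this into the symmetric form
  \<open>ln u * ln (1 - u) \<le> ln x * ln (1 - x)\<close>. Since \<open>p \<ge> 1\<close> gives \<open>u \<le> x \<le> 1 / 2\<close>, it is enough that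
  \<open>t \<mapsto> ln t * ln (1 - t)\<close> increases on the interval from \<open>0\<close> to \<open>1 / 2\<close>
  (\<open>ln_mult_ln_one_minus_mono\<close>). The sign of its derivative is that of
  \<open>(1 - t) * ln (1 - t) - t * ln t\<close>, which is nonnegative because \<open>ln\<close> is concave
  (\<open>mult_ln_le_one_minus_mult_ln\<close>).
\<close>

text \<open>
  For \<open>t \<le> 1 / 2\<close> the point \<open>1 - t\<close> lies between \<open>t\<close> and \<open>1\<close>, where it divides the interval with
  weight \<open>t / (1 - t)\<close> on \<open>t\<close>. As \<open>ln 1 = 0\<close>, concavity of \<open>ln\<close> gives
  \<open>ln (1 - t) \<ge> t / (1 - t) * ln t\<close>.
\<close>
lemma mult_ln_le_one_minus_mult_ln:
  fixes t :: real
  assumes "0 < t" "t \<le> 1 / 2"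
  shows "t * ln t \<le> (1 - t) * ln (1 - t)"
proof -
  define a where "a = t / (1 - t)"
  have a: "0 \<le> a" "a \<le> 1" using assms by (auto simp: a_def field_simps)
  have "a * (1 - t) = t" using assms by (simp add: a_def)
  then have point: "(1 - a) * 1 + a * t = 1 - t" by (simp add: algebra_simps)
  have "(1 - a) * ln 1 + a * ln t \<le> ln ((1 - a) * 1 + a * t)"
    using concave_onD[OF ln_concave a, of 1 t] assms by simp
  then have "a * ln t \<le> ln (1 - t)" unfolding point by simp
  then show ?thesis using assms by (simp add: a_def field_simps)
qed

lemma ln_mult_ln_one_minus_mono:
  fixes u x :: real
  assumes "0 < u" "u \<le> x" "x \<le> 1 / 2"
  shows "ln u * ln (1 - u) \<le> ln x * ln (1 - x)"
proof (rule DERIV_nonneg_imp_nondecreasing[OF \<open>u \<le> x\<close>])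
  fix t :: real
  assume "u \<le> t" "t \<le> x"
  then have t: "0 < t" "t \<le> 1 / 2" using assms by auto
  have "((\<lambda>t. ln t * ln (1 - t)) has_real_derivative
      ((1 - t) * ln (1 - t) - t * ln t) / (t * (1 - t))) (at t)"
    using t by (auto intro!: derivative_eq_intros simp: field_simps)
  moreover have "((1 - t) * ln (1 - t) - t * ln t) / (t * (1 - t)) \<ge> 0"
    using t mult_ln_le_one_minus_mult_ln[OF t] by simp
  ultimately show "\<exists>y. ((\<lambda>t. ln t * ln (1 - t)) has_real_derivative y) (at t) \<and> 0 \<le> y"
    by blast
qed

theorem theorem2:
  fixes p x :: real
  assumes "p \<ge> 1" and "0 \<le> x" and "x \<le> 1 / 2"
  shows "x powr p + (1 - x) powr (1 / p) \<le> 1"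
proof (cases "x = 0")
  case True
  then show ?thesis by simp
next
  case False
  then have x: "0 < x" "x < 1" using assms by auto
  define u where "u = x powr p"
  have u: "0 < u" "u \<le> x"
    using x assms powr_mono'[of 1 p x] by (auto simp: u_def)
  have "ln u = p * ln x" using x by (simp add: u_def ln_powr)
  then have "ln x * (p * ln (1 - u)) \<le> ln x * ln (1 - x)"
    using ln_mult_ln_one_minus_mono[OF u assms(3)] by (simp add: mult_ac)
  moreover have "ln x < 0" using x by simp
  ultimately have "ln (1 - x) \<le> p * ln (1 - u)" by (simp add: mult_le_cancel_left)
  then have "1 / p * ln (1 - x) \<le> ln (1 - u)" using assms by (simp add: field_simps)
  then have "exp (1 / p * ln (1 - x)) \<le> 1 - u" using u x by (simp add: ln_ge_iff)
  then have "(1 - x) powr (1 / p) \<le> 1 - u" using x by (simp add: powr_def)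
  then show ?thesis by (simp add: u_def)
qed

end
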